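(* Let $K\subset\mathbb R^n$ ($n\ge1$) be a convex body and let $p:\mathbb R^n\to\mathbb R$ be the projection to a coordinate, $p(x)=x_i$ for some fixed $i\in\{1,\dots,n\}$. Then $$\frac{p(\mathrm{Bc}\,K_{\ge t})-\min_K p}{p(\mathrm{Bc}\,K)-\min_K p}\ \ge\ \frac{|K|}{|K_{\ge t}|}\left(1-\left(1-\frac{|K_{\ge t}|}{|K|}\right)^{\frac{n+1}{n}}\right)\qquad\text{for all } t\in[\min_K p,\max_K p),$$ and $$\frac{\max_K p-p(\mathrm{Bc}\,K_{\le t})}{\max_K p-p(\mathrm{Bc}\,K)}\ \ge\ \frac{|K|}{|K_{\le t}|}\left(1-\left(1-\frac{|K_{\le t}|}{|K|}\right)^{\frac{n+1}{n}}\right)\qquad\text{for all } t\in(\min_K p,\max_K p].$$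
   Context: A convex body is a compact convex set with nonempty interior. $|\cdot|$ denotes Lebesgue measure on $\mathbb R^n$, and $\mathrm{Bc}\,K:=\frac{1}{|K|}\int_K x\,dx\in\mathbb R^n$ is the barycenter. $K_{\ge t}:=K\cap\{x\in\mathbb R^n: p(x)\ge t\}$ and $K_{\le t}:=K\cap\{x\in\mathbb R^n:p(x)\le t\}$. *)

theory Defs
  imports "HOL-Analysis.Analysis"
begin

definition convex_body :: "'a::euclidean_space set \<Rightarrow> bool" where
  "convex_body K \<longleftrightarrow> compact K \<and> convex K \<and> interior K \<noteq> {}"

definition barycenter :: "'a::euclidean_space set \<Rightarrow> 'a" where
  "barycenter K = (1 / measure lebesgue K) *\<^sub>R (LINT x:K|lebesgue. x)"

definition upper_part :: "('a \<Rightarrow> real) \<Rightarrow> 'a set \<Rightarrow> real \<Rightarrow> 'a set" where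
  "upper_part p K t = K \<inter> {x. p x \<ge> t}"

definition lower_part :: "('a \<Rightarrow> real) \<Rightarrow> 'a set \<Rightarrow> real \<Rightarrow> 'a set" where
  "lower_part p K t = K \<inter> {x. p x \<le> t}"

text \<open>
  \<^const>\<open>Min\<close> and \<^const>\<open>Max\<close> are meaningful on finite sets only, so the minimum and maximum of a
  function over a set are taken as infimum and supremum of the image. For a continuous function
  on a nonempty compact set they are attained, as the two lemmas below state.
\<close>

definition min_over :: "'a set \<Rightarrow> ('a \<Rightarrow> real) \<Rightarrow> real" where
  "min_over K p = Inf (p ` K)"

definition max_over :: "'a set \<Rightarrow> ('a \<Rightarrow> real) \<Rightarrow> real" where
  "max_over K p = Sup (p ` K)"

lemma min_over_attained:
  fixes K :: "'a::topological_space set"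
  assumes "compact K" "K \<noteq> {}" "continuous_on K p"
  shows "min_over K p \<in> p ` K" and "\<And>x. x \<in> K \<Longrightarrow> min_over K p \<le> p x"
proof -
  from continuous_attains_inf[OF assms] obtain a
    where a: "a \<in> K" "\<And>x. x \<in> K \<Longrightarrow> p a \<le> p x" by blast
  have "min_over K p = p a"
    unfolding min_over_def by (rule cInf_eq_minimum) (use a in auto)
  with a show "min_over K p \<in> p ` K" "\<And>x. x \<in> K \<Longrightarrow> min_over K p \<le> p x" by auto
qed

lemma max_over_attained:
  fixes K :: "'a::topological_space set"
  assumes "compact K" "K \<noteq> {}" "continuous_on K p"
  shows "max_over K p \<in> p ` K" and "\<And>x. x \<in> K \<Longrightarrow> p x \<le> max_over K p"
proof -
  from continuous_attains_sup[OF assms] obtain a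
    where a: "a \<in> K" "\<And>x. x \<in> K \<Longrightarrow> p x \<le> p a" by blast
  have "max_over K p = p a"
    unfolding max_over_def by (rule cSup_eq_maximum) (use a in auto)
  with a show "max_over K p \<in> p ` K" "\<And>x. x \<in> K \<Longrightarrow> p x \<le> max_over K p" by auto
qed

end

theory Submission
  imports Defs
begin

text \<open>
  Let \<open>g = p - min\<^sub>K p\<close>, let \<open>x\<^sub>0 \<in> K\<close> be a zero of \<open>g\<close>, and let \<open>w\<close> be the proportion of the volume
  of \<open>K\<close> that lies in \<open>{p < t}\<close>. The contraction \<open>L\<close> of \<open>K\<close> towards \<open>x\<^sub>0\<close> with ratio \<open>w\<^bsup>1/n\<^esup>\<close> is
  contained in \<open>K\<close>, has the same volume as \<open>K \<inter> {p < t}\<close>, and \<open>\<integral>\<^sub>L g = w\<^bsup>(n+1)/n\<^esup> \<integral>\<^sub>K g\<close>. Among the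
  subsets of \<open>K\<close> of that volume, the sublevel set has the smallest integral of \<open>g\<close>, so
  \<open>\<integral>\<^bsub>K \<inter> {p < t}\<^esub> g \<le> w\<^bsup>(n+1)/n\<^esup> \<integral>\<^sub>K g\<close>. Subtracting from \<open>\<integral>\<^sub>K g\<close> gives the first inequality;
  the second one is the first one for \<open>-p\<close>.
\<close>

lemma integrable_indicator_inner_diff:
  fixes a c :: "'a::euclidean_space"
  assumes "compact S"
  shows "integrable lborel (\<lambda>x. indicator S x * (a \<bullet> (x - c)) :: real)"
  using borel_integrable_compact[OF assms, of "\<lambda>x. a \<bullet> (x - c)"]
  by (simp add: continuous_intros)

lemma inner_barycenter_diff:
  fixes a c :: "'a::euclidean_space"
  assumes "compact S" "measure lborel S > 0"
  shows "a \<bullet> barycenter S - a \<bullet> c = (\<integral>x. indicator S x * (a \<bullet> (x - c)) \<partial>lborel) / measure lborel S"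
proof -
  have int: "integrable lborel (\<lambda>x. indicator S x *\<^sub>R x)"
    using borel_integrable_compact[OF assms(1), of "\<lambda>x. x"] by simp
  have S: "S \<in> sets borel" "emeasure lborel S < \<infinity>"
    using assms(1) emeasure_compact_finite borel_compact by auto
  have intS: "integrable lborel (\<lambda>x. indicator S x :: real)"
    using S by simp
  have bary: "barycenter S = (1 / measure lborel S) *\<^sub>R (\<integral>x. indicator S x *\<^sub>R x \<partial>lborel)"
    unfolding barycenter_def set_lebesgue_integral_def
    using int S by (subst integral_completion) auto
  have "(\<integral>x. indicator S x * (a \<bullet> (x - c)) \<partial>lborel)
      = (\<integral>x. a \<bullet> (indicator S x *\<^sub>R x) - indicator S x * (a \<bullet> c) \<partial>lborel)"
    by (intro Bochner_Integration.integral_cong) (auto simp: algebra_simps)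
  also have "\<dots> = a \<bullet> (\<integral>x. indicator S x *\<^sub>R x \<partial>lborel) - measure lborel S * (a \<bullet> c)"
    using int intS S
    by (subst Bochner_Integration.integral_diff)
      (auto simp del: inner_scaleR_right intro!: integrable_inner_right)
  finally show ?thesis
    using assms(2) by (simp add: bary field_simps)
qed

lemma integral_lborel_dilation:
  fixes h :: "'a::euclidean_space \<Rightarrow> real"
  assumes "h \<in> borel_measurable borel" "r > 0"
  shows "(\<integral>x. h x \<partial>lborel) = r ^ DIM('a) * (\<integral>x. h (c + r *\<^sub>R x) \<partial>lborel)"
proof -
  have "(\<integral>x. h x \<partial>lborel)
      = (\<integral>x. h x \<partial>(density (distr lborel borel (\<lambda>x. c + r *\<^sub>R x)) (\<lambda>_. r ^ DIM('a))))"
    using lborel_affine[of r c] assms(2) by simp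
  also have "\<dots> = (\<integral>x. r ^ DIM('a) *\<^sub>R h (c + r *\<^sub>R x) \<partial>lborel)"
    using assms by (subst integral_density) (auto simp: integral_distr)
  finally show ?thesis by simp
qed

lemma sublevel_integral_le:
  fixes K :: "'a::euclidean_space set"
  assumes K: "compact K" "convex K" "measure lborel K > 0"
    and x0: "x0 \<in> K"
    and U: "U = K \<inter> {x. t \<le> a \<bullet> x}"
    and w: "w = measure lborel (K - U) / measure lborel K"
  shows "(\<integral>x. indicator (K - U) x * (a \<bullet> (x - x0)) \<partial>lborel)
      \<le> w powr ((real DIM('a) + 1) / real DIM('a)) * (\<integral>x. indicator K x * (a \<bullet> (x - x0)) \<partial>lborel)"
proof -
  let ?n = "DIM('a)"
  define g where "g x = a \<bullet> (x - x0)" for x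
  have [measurable]: "g \<in> borel_measurable borel"
    unfolding g_def by measurable
  have cU: "compact U"
    unfolding U by (intro compact_Int_closed K closed_halfspace_ge)
  have bK[measurable]: "K \<in> sets borel" and bU[measurable]: "U \<in> sets borel"
    using K(1) cU by (auto intro: borel_compact)
  have fK: "emeasure lborel K < \<infinity>" using K(1) emeasure_compact_finite by auto
  have fA: "emeasure lborel (K - U) < \<infinity>"
    using emeasure_mono[of "K - U" K lborel] fK by (auto intro: order.strict_trans1)
  have iK: "integrable lborel (\<lambda>x. indicator K x * g x)"
    unfolding g_def by (rule integrable_indicator_inner_diff[OF K(1)])
  have iA: "integrable lborel (\<lambda>x. indicator (K - U) x * g x)"
    by (rule Bochner_Integration.integrable_bound[OF iK]) (auto simp: indicator_def)
  have w01: "0 \<le> w" "w \<le> 1"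
  proof -
    show "0 \<le> w" by (simp add: w)
    have "measure lborel (K - U) \<le> measure lborel K"
      using fK by (intro measure_mono_fmeasurable) (auto simp: fmeasurable_def)
    then show "w \<le> 1" using K(3) by (simp add: w)
  qed
  show ?thesis
  proof (cases "w = 0")
    case True
    then have "measure lborel (K - U) = 0" using w K(3) by simp
    then have "K - U \<in> null_sets lborel"
      using fA by (intro null_setsI) (auto simp: emeasure_eq_ennreal_measure top.not_eq_extremum)
    then have "AE x in lborel. indicator (K - U) x * g x = 0"
      by (rule AE_I') (auto simp: indicator_def)
    then have "(\<integral>x. indicator (K - U) x * g x \<partial>lborel) = 0"
      by (rule integral_eq_zero_AE)
    then show ?thesis using True by (simp add: g_def)
  next
    case False
    define r where "r = w powr (1 / ?n)"
    have r: "0 < r" "r \<le> 1"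
      using w01 False by (auto simp: r_def powr_le1)
    have rn: "r ^ ?n = w"
      using w01 False by (simp add: r_def powr_realpow[symmetric] powr_powr)
    define \<phi> where "\<phi> x = (1 - r) *\<^sub>R x0 + r *\<^sub>R x" for x
    define L where "L = \<phi> ` K"
    have LK: "L \<subseteq> K"
      using K(2) x0 r unfolding L_def \<phi>_def by (auto intro!: convexD)
    have cL: "compact L"
      unfolding L_def \<phi>_def by (intro compact_continuous_image K(1) continuous_intros)
    then have bL[measurable]: "L \<in> sets borel" by (rule borel_compact)
    have fL: "emeasure lborel L < \<infinity>" using cL emeasure_compact_finite by auto
    have iL: "integrable lborel (\<lambda>x. indicator L x * g x)"
      unfolding g_def by (rule integrable_indicator_inner_diff[OF cL])
    have mem: "\<phi> x \<in> L \<longleftrightarrow> x \<in> K" for x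
      using r unfolding L_def \<phi>_def by auto
    have g\<phi>: "g (\<phi> x) = r * g x" for x
      by (simp add: g_def \<phi>_def algebra_simps)
    have "(\<integral>x. indicator L x \<partial>lborel) = r ^ ?n * (\<integral>x. indicator L (\<phi> x) \<partial>lborel)"
      unfolding \<phi>_def by (rule integral_lborel_dilation) (use r in auto)
    moreover have "(\<lambda>x. indicator L (\<phi> x)) = (indicator K :: 'a \<Rightarrow> real)"
      by (simp add: fun_eq_iff indicator_def mem)
    ultimately have mL: "measure lborel L = measure lborel (K - U)"
      using K(3) by (simp add: rn w)
    have "(\<integral>x. indicator L x * g x \<partial>lborel) = r ^ ?n * (\<integral>x. indicator L (\<phi> x) * g (\<phi> x) \<partial>lborel)"
      unfolding \<phi>_def by (rule integral_lborel_dilation) (use r in auto)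
    also have "(\<lambda>x. indicator L (\<phi> x) * g (\<phi> x)) = (\<lambda>x. r * (indicator K x * g x))"
      by (auto simp: fun_eq_iff indicator_def mem g\<phi>)
    also have "r ^ ?n * (\<integral>x. r * (indicator K x * g x) \<partial>lborel)
        = w powr ((real ?n + 1) / real ?n) * (\<integral>x. indicator K x * g x \<partial>lborel)"
    proof -
      have "w powr ((real ?n + 1) / real ?n) = w * r"
        using w01 False by (simp add: r_def add_divide_distrib powr_add)
      then show ?thesis by (simp add: rn)
    qed
    finally have gL: "(\<integral>x. indicator L x * g x \<partial>lborel)
        = w powr ((real ?n + 1) / real ?n) * (\<integral>x. indicator K x * g x \<partial>lborel)" .
    let ?s = "t - a \<bullet> x0"
    have "(\<integral>x. indicator (K - U) x * g x - ?s * indicator (K - U) x \<partial>lborel)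
        \<le> (\<integral>x. indicator L x * g x - ?s * indicator L x \<partial>lborel)"
    proof (rule integral_mono)
      show "integrable lborel (\<lambda>x. indicator (K - U) x * g x - ?s * indicator (K - U) x)"
        "integrable lborel (\<lambda>x. indicator L x * g x - ?s * indicator L x)"
        using iA iL fA fL by simp_all
    qed (use LK in \<open>auto simp: indicator_def U g_def algebra_simps\<close>)
    then have "(\<integral>x. indicator (K - U) x * g x \<partial>lborel) \<le> (\<integral>x. indicator L x * g x \<partial>lborel)"
      using iA iL fA fL mL by simp
    then show ?thesis unfolding gL by (simp add: g_def)
  qed
qed

lemma measure_convex_body_halfspace_pos:
  fixes K :: "'a::euclidean_space set"
  assumes "convex_body K" "y \<in> K" "t < a \<bullet> y"
  shows "measure lborel (K \<inter> {x. t \<le> a \<bullet> x}) > 0"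
proof -
  have K: "compact K" "convex K" "interior K \<noteq> {}"
    using assms(1) by (auto simp: convex_body_def)
  have "y \<in> closure (interior K)"
    using convex_closure_interior[OF K(2,3)] assms(2) closure_subset by auto
  then have "interior K \<inter> {x. t < a \<bullet> x} \<noteq> {}"
    using assms(3) open_halfspace_gt[of t a]
    by (auto simp: closure_iff_nhds_not_empty inf_commute)
  moreover have "open (interior K \<inter> {x. t < a \<bullet> x})"
    by (auto intro: open_halfspace_gt)
  ultimately have "interior (K \<inter> {x. t \<le> a \<bullet> x}) \<noteq> {}"
    using interior_maximal[of "interior K \<inter> {x. t < a \<bullet> x}" "K \<inter> {x. t \<le> a \<bullet> x}"] interior_subset
    by fastforce
  then have nn: "\<not> negligible (K \<inter> {x. t \<le> a \<bullet> x})"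
    by (meson open_interior open_not_negligible interior_subset negligible_subset)
  have cU: "compact (K \<inter> {x. t \<le> a \<bullet> x})"
    by (intro compact_Int_closed K closed_halfspace_ge)
  from nn have "K \<inter> {x. t \<le> a \<bullet> x} \<notin> null_sets lborel"
    by (auto simp: negligible_iff_null_sets null_sets_completionI)
  then have "emeasure lborel (K \<inter> {x. t \<le> a \<bullet> x}) \<noteq> 0"
    using borel_compact[OF cU] by (auto simp: null_sets_def)
  then show ?thesis
    using emeasure_compact_finite[OF cU]
    by (simp add: measure_def enn2real_positive_iff zero_less_iff_neq_zero)
qed

lemma barycenter_halfspace_ratio:
  fixes K :: "'a::euclidean_space set"
  assumes K: "convex_body K"
    and x0: "x0 \<in> K" "\<And>x. x \<in> K \<Longrightarrow> a \<bullet> x0 \<le> a \<bullet> x"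
    and y: "y \<in> K" "t < a \<bullet> y" and t: "a \<bullet> x0 \<le> t"
    and U: "U = K \<inter> {x. t \<le> a \<bullet> x}"
  shows "(a \<bullet> barycenter U - a \<bullet> x0) / (a \<bullet> barycenter K - a \<bullet> x0)
      \<ge> measure lebesgue K / measure lebesgue U
         * (1 - (1 - measure lebesgue U / measure lebesgue K) powr ((real DIM('a) + 1) / real DIM('a)))"
proof -
  have cK: "compact K" "convex K" using K by (auto simp: convex_body_def)
  have cU: "compact U"
    unfolding U by (intro compact_Int_closed cK closed_halfspace_ge)
  have bK[measurable]: "K \<in> sets borel" and bU[measurable]: "U \<in> sets borel"
    using cK cU by (auto intro: borel_compact)
  have UK: "U \<subseteq> K" by (auto simp: U)
  have fin: "emeasure lborel K < \<infinity>" "emeasure lborel U < \<infinity>"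
    using cK cU emeasure_compact_finite by auto
  have mU: "measure lborel U > 0"
    unfolding U by (rule measure_convex_body_halfspace_pos[OF K y])
  also have "measure lborel U \<le> measure lborel K"
    using fin UK by (intro measure_mono_fmeasurable) (auto simp: fmeasurable_def)
  finally have mK: "measure lborel K > 0" .
  define I where "I S = (\<integral>x. indicator S x * (a \<bullet> (x - x0)) \<partial>lborel)" for S
  note int = integrable_indicator_inner_diff[of _ a x0]
  define s where "s = (a \<bullet> x0 + a \<bullet> y) / 2"
  define S where "S = K \<inter> {x. s \<le> a \<bullet> x}"
  have s: "a \<bullet> x0 < s" "s < a \<bullet> y" using y t by (auto simp: s_def)
  have cS: "compact S"
    unfolding S_def by (intro compact_Int_closed cK closed_halfspace_ge)
  have fS: "emeasure lborel S < \<infinity>" "S \<in> sets borel" using cS emeasure_compact_finite borel_compact by auto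
  have "0 < (s - a \<bullet> x0) * measure lborel S"
    using s measure_convex_body_halfspace_pos[OF K y(1), of s] by (simp add: S_def)
  also have "\<dots> = (\<integral>x. (s - a \<bullet> x0) * indicator S x \<partial>lborel)"
    by simp
  also have "\<dots> \<le> I K"
    unfolding I_def
  proof (rule integral_mono)
    show "integrable lborel (\<lambda>x. (s - a \<bullet> x0) * indicator S x)"
      using fS by simp
  qed (use int[OF cK(1)] x0(2) in \<open>auto simp: S_def indicator_def algebra_simps\<close>)
  finally have IK: "I K > 0" .
  define w where "w = measure lborel (K - U) / measure lborel K"
  have "measure lborel (K - U) = measure lborel K - measure lborel U"
    using fin UK by (intro measurable_measure_Diff) (auto simp: fmeasurable_def)
  then have w: "w = 1 - measure lborel U / measure lborel K"
    using mK by (simp add: w_def diff_divide_distrib)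
  have "I (K - U) = (\<integral>x. indicator K x * (a \<bullet> (x - x0)) - indicator U x * (a \<bullet> (x - x0)) \<partial>lborel)"
    unfolding I_def using UK by (intro Bochner_Integration.integral_cong) (auto simp: indicator_def)
  also have "\<dots> = I K - I U"
    unfolding I_def by (intro Bochner_Integration.integral_diff int cK cU)
  finally have "I U = I K - I (K - U)" by simp
  moreover have "I (K - U) \<le> w powr ((real DIM('a) + 1) / real DIM('a)) * I K"
    unfolding I_def by (rule sublevel_integral_le[OF cK mK x0(1) U w_def])
  ultimately have "(1 - w powr ((real DIM('a) + 1) / real DIM('a))) * I K \<le> I U"
    by (simp add: algebra_simps)
  then have le: "1 - w powr ((real DIM('a) + 1) / real DIM('a)) \<le> I U / I K"
    using IK by (simp add: field_simps)
  have "measure lborel K / measure lborel U * (1 - w powr ((real DIM('a) + 1) / real DIM('a)))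
      \<le> measure lborel K / measure lborel U * (I U / I K)"
    using mK mU by (intro mult_left_mono le) auto
  also have "\<dots> = (a \<bullet> barycenter U - a \<bullet> x0) / (a \<bullet> barycenter K - a \<bullet> x0)"
    using mK mU by (simp add: inner_barycenter_diff cK cU I_def)
  finally show ?thesis
    by (simp add: w)
qed

theorem theorem2p2:
  fixes K :: "(real ^ 'n) set" and i :: 'n and p :: "real ^ 'n \<Rightarrow> real"
  assumes "convex_body K"
    and "p = (\<lambda>x. x $ i)"
  shows "(\<forall>t \<in> {min_over K p ..< max_over K p}.
            (p (barycenter (upper_part p K t)) - min_over K p) / (p (barycenter K) - min_over K p)
            \<ge> measure lebesgue K / measure lebesgue (upper_part p K t)
               * (1 - (1 - measure lebesgue (upper_part p K t) / measure lebesgue K)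
                        powr ((real CARD('n) + 1) / real CARD('n))))
       \<and> (\<forall>t \<in> {min_over K p <.. max_over K p}.
            (max_over K p - p (barycenter (lower_part p K t))) / (max_over K p - p (barycenter K))
            \<ge> measure lebesgue K / measure lebesgue (lower_part p K t)
               * (1 - (1 - measure lebesgue (lower_part p K t) / measure lebesgue K)
                        powr ((real CARD('n) + 1) / real CARD('n))))"
proof -
  have "compact K" "K \<noteq> {}" "continuous_on K p"
    using assms interior_subset by (fastforce simp: convex_body_def intro: continuous_intros)+
  note min = min_over_attained[OF this] and max = max_over_attained[OF this]
  obtain x0 where x0: "x0 \<in> K" "min_over K p = p x0" using min(1) by auto
  obtain x1 where x1: "x1 \<in> K" "max_over K p = p x1" using max(1) by auto
  have p: "axis i 1 \<bullet> x = p x" for x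
    by (simp add: assms(2) inner_axis')
  show ?thesis
  proof (intro conjI ballI)
    fix t assume "t \<in> {min_over K p ..< max_over K p}"
    then show "(p (barycenter (upper_part p K t)) - min_over K p) / (p (barycenter K) - min_over K p)
            \<ge> measure lebesgue K / measure lebesgue (upper_part p K t)
               * (1 - (1 - measure lebesgue (upper_part p K t) / measure lebesgue K)
                        powr ((real CARD('n) + 1) / real CARD('n)))"
      using barycenter_halfspace_ratio[OF assms(1) x0(1), of "axis i 1" x1 t "upper_part p K t"]
        min(2) x0 x1
      by (simp add: p upper_part_def)
  next
    fix t assume "t \<in> {min_over K p <.. max_over K p}"
    moreover have "(- p b + p x1) / (- p c + p x1) = (p x1 - p b) / (p x1 - p c)" for b c
      by simp
    ultimately show "(max_over K p - p (barycenter (lower_part p K t))) / (max_over K p - p (barycenter K))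
            \<ge> measure lebesgue K / measure lebesgue (lower_part p K t)
               * (1 - (1 - measure lebesgue (lower_part p K t) / measure lebesgue K)
                        powr ((real CARD('n) + 1) / real CARD('n)))"
      using barycenter_halfspace_ratio[OF assms(1) x1(1), of "- axis i 1" x0 "- t" "lower_part p K t"]
        max(2) x0 x1
      by (simp add: p lower_part_def)
  qed
qed

end
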